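(* Let $N\ge2$ be an integer, $l>0$, $\varepsilon_A,\varepsilon_B\in[0,1)$, $\varepsilon=\max\{\varepsilon_A,\varepsilon_B\}$, and let $\kappa>\frac{N^2}{l(1-\varepsilon)^2}$. Consider any hidden-variable (HV) model for settings $x,y\in\{0,1\}$ and outcomes $a,b\in\{0,1\}^N$ that is $l$-measurement dependent, $(\varepsilon_A,\varepsilon_B)$-parameter dependent, satisfies outcome independence, and whose setting distribution is uniform, $p(x,y)=\frac14$ for all $x,y$. Let $p(a,b\mid x,y)$ be the correlation it produces and define $$I_\kappa^N(p)=\sum_{\substack{a,b\\ \exists i:(a_i,b_i)=(0,0)}}p(a,b\mid0,0)-\kappa\sum_{\substack{a,b\\ \exists i:(a_i,b_i)=(0,1)}}p(a,b\mid0,1)-\kappa\sum_{\substack{a,b\\ \exists i:(a_i,b_i)=(1,0)}}p(a,b\mid1,0)-\kappa\sum_{\substack{a,b\\ \exists i:(a_i,b_i)=(0,0)}}p(a,b\mid1,1).$$ Then $$I_\kappa^N(p)\le\tilde\varepsilon_A+\tilde\varepsilon_B-\tilde\varepsilon_A\tilde\varepsilon_B,\qquad\text{where}\quad \tilde\varepsilon_A=\varepsilon_A+N\sqrt{\tfrac{1}{l\kappa}},\quad \tilde\varepsilon_B=\varepsilon_B+N\sqrt{\tfrac{1}{l\kappa}}.$$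
   Context: HV model: a probability space $(\Lambda,\mu)$ of hidden variables $\lambda$; for each $\lambda$ a probability distribution $p(x,y\mid\lambda)$ on pairs of settings; and for each $\lambda,x,y$ a probability distribution $p(a,b\mid\lambda,x,y)$ on pairs of outcomes (all measurable in $\lambda$). The setting distribution is $p(x,y)=\int p(x,y\mid\lambda)\,d\mu(\lambda)$, and the correlation produced is $$p(a,b\mid x,y)=\frac{1}{p(x,y)}\int p(x,y\mid\lambda)\,p(a,b\mid\lambda,x,y)\,d\mu(\lambda).$$ Marginals: $p(a\mid\lambda,x,y)=\sum_b p(a,b\mid\lambda,x,y)$ and $p(b\mid\lambda,x,y)=\sum_a p(a,b\mid\lambda,x,y)$. $l$-measurement dependent: $p(x,y\mid\lambda)\ge l$ for all $x,y,\lambda$. Outcome independence: $p(a,b\mid\lambda,x,y)=p(a\mid\lambda,x,y)\,p(b\mid\lambda,x,y)$ for all $a,b,x,y,\lambda$. $(\varepsilon_A,\varepsilon_B)$-parameter dependent: for all $\lambda$, all $x,y,y'$: $\frac12\sum_a|p(a\mid\lambda,x,y)-p(a\mid\lambda,x,y')|\le\varepsilon_A$; and for all $\lambda$, all $y,x,x'$: $\frac12\sum_b|p(b\mid\lambda,x,y)-p(b\mid\lambda,x',y)|\le\varepsilon_B$. Outcomes are written $a=(a_1,\dots,a_N)$, $b=(b_1,\dots,b_N)$. *)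

theory Defs
  imports "HOL-Probability.Probability"
begin

text \<open>
  A hidden-variable model consists of a measure \<open>M\<close> on hidden variables, a family \<open>S\<close> with
  \<open>pmf (S \<lambda>) (x, y)\<close> standing for p(x,y | \<open>\<lambda>\<close>), and a family \<open>R\<close> with
  \<open>pmf (R \<lambda> x y) (a, b)\<close> standing for p(a,b | \<open>\<lambda>\<close>,x,y).
\<close>

definition hv_model ::
  "'l measure \<Rightarrow> ('l \<Rightarrow> ('x \<times> 'y) pmf) \<Rightarrow> ('l \<Rightarrow> 'x \<Rightarrow> 'y \<Rightarrow> ('a \<times> 'b) pmf) \<Rightarrow> bool"
  where "hv_model M S R \<longleftrightarrow>
    prob_space M \<and>
    (\<forall>x y. (\<lambda>h. pmf (S h) (x, y)) \<in> borel_measurable M) \<and>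
    (\<forall>x y a b. (\<lambda>h. pmf (R h x y) (a, b)) \<in> borel_measurable M)"

definition setting_dist ::
  "'l measure \<Rightarrow> ('l \<Rightarrow> ('x \<times> 'y) pmf) \<Rightarrow> 'x \<Rightarrow> 'y \<Rightarrow> real"
  where "setting_dist M S x y = (\<integral>h. pmf (S h) (x, y) \<partial>M)"

text \<open>\<open>correlation M S R a b x y\<close> stands for p(a,b | x,y).\<close>

definition correlation ::
  "'l measure \<Rightarrow> ('l \<Rightarrow> ('x \<times> 'y) pmf) \<Rightarrow> ('l \<Rightarrow> 'x \<Rightarrow> 'y \<Rightarrow> ('a \<times> 'b) pmf) \<Rightarrow>
    'a \<Rightarrow> 'b \<Rightarrow> 'x \<Rightarrow> 'y \<Rightarrow> real"
  where "correlation M S R a b x y =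
    1 / setting_dist M S x y * (\<integral>h. pmf (S h) (x, y) * pmf (R h x y) (a, b) \<partial>M)"

definition marginal_A ::
  "('l \<Rightarrow> 'x \<Rightarrow> 'y \<Rightarrow> ('a \<times> 'b::finite) pmf) \<Rightarrow> 'a \<Rightarrow> 'l \<Rightarrow> 'x \<Rightarrow> 'y \<Rightarrow> real"
  where "marginal_A R a h x y = (\<Sum>b\<in>UNIV. pmf (R h x y) (a, b))"

definition marginal_B ::
  "('l \<Rightarrow> 'x \<Rightarrow> 'y \<Rightarrow> ('a::finite \<times> 'b) pmf) \<Rightarrow> 'b \<Rightarrow> 'l \<Rightarrow> 'x \<Rightarrow> 'y \<Rightarrow> real"
  where "marginal_B R b h x y = (\<Sum>a\<in>UNIV. pmf (R h x y) (a, b))"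

definition measurement_dependent ::
  "real \<Rightarrow> 'l measure \<Rightarrow> ('l \<Rightarrow> ('x \<times> 'y) pmf) \<Rightarrow> bool"
  where "measurement_dependent l M S \<longleftrightarrow>
    (\<forall>h\<in>space M. \<forall>x y. pmf (S h) (x, y) \<ge> l)"

definition outcome_independent ::
  "'l measure \<Rightarrow> ('l \<Rightarrow> 'x \<Rightarrow> 'y \<Rightarrow> ('a::finite \<times> 'b::finite) pmf) \<Rightarrow> bool"
  where "outcome_independent M R \<longleftrightarrow>
    (\<forall>h\<in>space M. \<forall>x y a b.
      pmf (R h x y) (a, b) = marginal_A R a h x y * marginal_B R b h x y)"

definition parameter_dependent ::
  "real \<Rightarrow> real \<Rightarrow> 'l measure \<Rightarrow>
    ('l \<Rightarrow> 'x \<Rightarrow> 'y \<Rightarrow> ('a::finite \<times> 'b::finite) pmf) \<Rightarrow> bool"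
  where "parameter_dependent \<epsilon>A \<epsilon>B M R \<longleftrightarrow>
    (\<forall>h\<in>space M. \<forall>x y y'.
      1 / 2 * (\<Sum>a\<in>UNIV. \<bar>marginal_A R a h x y - marginal_A R a h x y'\<bar>) \<le> \<epsilon>A) \<and>
    (\<forall>h\<in>space M. \<forall>y x x'.
      1 / 2 * (\<Sum>b\<in>UNIV. \<bar>marginal_B R b h x y - marginal_B R b h x' y\<bar>) \<le> \<epsilon>B)"

text \<open>
  Bits are encoded as booleans, with \<open>False\<close> for 0 and \<open>True\<close> for 1; an outcome in
  \<open>{0,1}\<close>\<open>\<^sup>N\<close> is a vector \<open>bool ^ 'n\<close> with \<open>N = CARD('n)\<close>.
\<close>

abbreviation (input) b0 :: bool where "b0 \<equiv> False"
abbreviation (input) b1 :: bool where "b1 \<equiv> True"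

definition some_coord ::
  "bool \<Rightarrow> bool \<Rightarrow> ((bool ^ 'n) \<times> (bool ^ 'n)) set"
  where "some_coord s t = {(a, b). \<exists>i. (a $ i, b $ i) = (s, t)}"

definition I_functional ::
  "real \<Rightarrow> (bool ^ 'n::finite \<Rightarrow> bool ^ 'n \<Rightarrow> bool \<Rightarrow> bool \<Rightarrow> real) \<Rightarrow> real"
  where "I_functional \<kappa> p =
      (\<Sum>(a, b)\<in>some_coord b0 b0. p a b b0 b0)
    - \<kappa> * (\<Sum>(a, b)\<in>some_coord b0 b1. p a b b0 b1)
    - \<kappa> * (\<Sum>(a, b)\<in>some_coord b1 b0. p a b b1 b0)
    - \<kappa> * (\<Sum>(a, b)\<in>some_coord b0 b0. p a b b1 b1)"

end

(*
  Put s = sqrt (1 / (l * \<kappa>)), so that N s < 1 - \<epsilon>, and fix the hidden variable.  The two outcomes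
  are then independent.  Suppose first that every coordinate i has P(a_i = 0 | 0,1) \<le> s or
  P(b_i = 0 | 1,0) \<le> s.  The event "a_i = b_i = 0 for some i" at settings (0,0) forces a_i = 0 for
  an i of the first kind or b_i = 0 for an i of the second kind; by parameter dependence and the
  union bound these two independent events have probability at most \<epsilon>A + N s and \<epsilon>B + N s.
  If instead some coordinate violates both bounds, then the three penalised probabilities add up
  to at least s^2, which cancels the positive term.  As l \<le> p(x,y|\<lambda>) and p(0,0|\<lambda>) \<le> 1,
  the penalty weights are at least l p(0,0|\<lambda>), so that the estimate can be integrated against
  p(0,0|\<lambda>).
*)

theory Submission
  imports Defs
begin

section \<open>Finite distributions and the estimate for a fixed hidden variable\<close>

lemma prob_le_prob_plus_total_variation:
  fixes p q :: "'a::finite pmf"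
  shows "measure_pmf.prob p F \<le> measure_pmf.prob q F + 1 / 2 * (\<Sum>a\<in>UNIV. \<bar>pmf p a - pmf q a\<bar>)"
proof -
  let ?d = "\<lambda>a. pmf p a - pmf q a"
  have 1: "sum ?d F = measure_pmf.prob p F - measure_pmf.prob q F"
    by (simp add: measure_measure_pmf_finite sum_subtractf)
  have 2: "sum ?d (- F) = measure_pmf.prob p (- F) - measure_pmf.prob q (- F)"
    by (simp add: measure_measure_pmf_finite sum_subtractf)
  have 3: "measure_pmf.prob r (- F) = 1 - measure_pmf.prob r F" for r :: "'a pmf"
    using measure_pmf.prob_compl[of F r] by (simp add: Compl_eq_Diff_UNIV)
  \<comment> \<open>Both total masses are 1, so the differences over \<open>F\<close> and
    \<open>- F\<close> are opposite and the left side is twice the one over \<open>F\<close>; hence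
    the factor 1/2.\<close>
  have "sum ?d F - sum ?d (- F) \<le> (\<Sum>a\<in>F. \<bar>?d a\<bar>) + (\<Sum>a\<in>- F. \<bar>?d a\<bar>)"
    using sum_abs[of ?d F] sum_abs[of ?d "- F"] by linarith
  also have "\<dots> = (\<Sum>a\<in>UNIV. \<bar>?d a\<bar>)"
    using sum.union_disjoint[of F "- F" "\<lambda>a. \<bar>?d a\<bar>"] by simp
  finally show ?thesis
    using 1 2 3 by simp
qed

lemma prob_pair_pmf_Times:
  fixes p :: "'a::finite pmf" and q :: "'b::finite pmf"
  shows "measure_pmf.prob (pair_pmf p q) (A \<times> B) = measure_pmf.prob p A * measure_pmf.prob q B"
  by (rule measure_pmf_prob_product) (auto intro: countable_finite)

text \<open>The three summands bound the penalised probabilities at one coordinate from below;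
  \<open>d\<close> and \<open>e\<close> are the parameter dependences. If \<open>u \<le> d\<close>
  or \<open>v \<le> e\<close>, a single factor \<open>1 - u\<close> or \<open>1 - v\<close> is
  already at least \<open>s\<close>. Otherwise \<open>u' * v'\<close> is at least
  \<open>(u - d) * (v - e)\<close>.\<close>

lemma penalty_lower_bound:
  fixes s a b u v u' v' d e :: real
  assumes s: "0 < s" "s \<le> 1 - d" "s \<le> 1 - e"
    and ab: "s \<le> a" "s \<le> b"
    and uv: "u \<le> 1" "v \<le> 1"
    and u': "0 \<le> u'" "u - d \<le> u'"
    and v': "0 \<le> v'" "v - e \<le> v'"
  shows "s\<^sup>2 \<le> a * (1 - v) + (1 - u) * b + u' * v'"
proof -
  have a: "s * (1 - v) \<le> a * (1 - v)" and b: "s * (1 - u) \<le> (1 - u) * b"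
    using ab uv by (auto simp: mult_right_mono mult_left_mono mult.commute)
  have sd: "s * s \<le> s * (1 - d)" and se: "s * s \<le> s * (1 - e)"
    using s by (auto intro: mult_left_mono)
  have nn: "0 \<le> s * (1 - u)" "0 \<le> s * (1 - v)" "0 \<le> u' * v'"
    using s uv u' v' by auto
  consider "u \<le> d" | "v \<le> e" | "d \<le> u" "e \<le> v" by linarith
  then have "s * s \<le> s * (1 - v) + s * (1 - u) + u' * v'"
  proof cases
    case 1
    then have "s * (1 - d) \<le> s * (1 - u)" using s by (intro mult_left_mono) auto
    then show ?thesis using sd nn by linarith
  next
    case 2
    then have "s * (1 - e) \<le> s * (1 - v)" using s by (intro mult_left_mono) auto
    then show ?thesis using se nn by linarith
  next
    case 3
    have uv': "(u - d) * (v - e) \<le> u' * v'"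
      using 3 u' v' by (intro mult_mono) auto
    \<comment> \<open>With \<open>(u - d) * (v - e)\<close> in place of \<open>u' * v'\<close>, the
      right side is affine in \<open>u\<close> with slope \<open>v - e - s\<close>. The sign of the
      slope decides whether \<open>u = d\<close> or \<open>u = 1\<close> is the worst case.\<close>
    show ?thesis
    proof (cases "s \<le> v - e")
      case True
      then have "(u - d) * s \<le> (u - d) * (v - e)" using 3 by (intro mult_left_mono) auto
      then have "s * (1 - d) \<le> s * (1 - u) + u' * v'"
        using uv' by (simp add: algebra_simps)
      then show ?thesis using sd nn by linarith
    next
      case False
      \<comment> \<open>Comparison with \<open>u = 1\<close> leaves
        \<open>s * (1 - v) + (1 - d) * (v - e)\<close>, and \<open>s \<le> 1 - d\<close> turns this
        into \<open>s * (1 - e)\<close>.\<close>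
      have "(u - d) * (s - (v - e)) \<le> (1 - d) * (s - (v - e))"
        using False uv by (intro mult_right_mono) auto
      moreover have "s * (v - e) \<le> (1 - d) * (v - e)"
        using 3 s by (intro mult_right_mono) auto
      ultimately have "s * (1 - e) \<le> s * (1 - v) + s * (1 - u) + u' * v'"
        using uv' by (simp add: algebra_simps)
      then show ?thesis using se by linarith
    qed
  qed
  then show ?thesis using a b by (simp add: power2_eq_square)
qed

lemma prob_ex_coord_le:
  fixes p :: "(bool ^ 'n::finite) pmf"
  assumes "\<And>i. i \<in> G \<Longrightarrow> measure_pmf.prob p {a. \<not> a $ i} \<le> s" and "0 \<le> s"
  shows "measure_pmf.prob p {a. \<exists>i\<in>G. \<not> a $ i} \<le> real CARD('n) * s"
proof -
  have "{a. \<exists>i\<in>G. \<not> a $ i} = (\<Union>i\<in>G. {a :: bool ^ 'n. \<not> a $ i})" by auto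
  then have "measure_pmf.prob p {a. \<exists>i\<in>G. \<not> a $ i} \<le> (\<Sum>i\<in>G. measure_pmf.prob p {a. \<not> a $ i})"
    by (simp add: measure_pmf.finite_measure_subadditive_finite)
  also have "\<dots> \<le> real (card G) * s"
    using sum_bounded_above[of G "\<lambda>i. measure_pmf.prob p {a. \<not> a $ i}" s] assms(1) by simp
  also have "\<dots> \<le> real CARD('n) * s"
    using assms(2) by (intro mult_right_mono) (auto intro: card_mono)
  finally show ?thesis .
qed

text \<open>Here \<open>\<alpha> x y\<close> and \<open>\<beta> x y\<close> play the two outcome
  marginals at a fixed hidden variable. The weight \<open>1 / s\<^sup>2\<close> becomes
  \<open>l * \<kappa>\<close> later.\<close>

lemma product_strategy_bound:
  fixes \<alpha> \<beta> :: "bool \<Rightarrow> bool \<Rightarrow> (bool ^ 'n::finite) pmf" and s d e :: real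
  assumes s: "0 < s" "d + real CARD('n) * s \<le> 1" "e + real CARD('n) * s \<le> 1"
    and de: "0 \<le> d" "0 \<le> e"
    and \<alpha>: "\<And>x y y' F. measure_pmf.prob (\<alpha> x y) F \<le> measure_pmf.prob (\<alpha> x y') F + d"
    and \<beta>: "\<And>x x' y F. measure_pmf.prob (\<beta> x y) F \<le> measure_pmf.prob (\<beta> x' y) F + e"
  defines "P \<equiv> \<lambda>x y. measure_pmf.prob (pair_pmf (\<alpha> x y) (\<beta> x y))"
    and "d' \<equiv> d + real CARD('n) * s" and "e' \<equiv> e + real CARD('n) * s"
  shows "P b0 b0 (some_coord b0 b0)
      - (P b0 b1 (some_coord b0 b1) + P b1 b0 (some_coord b1 b0) + P b1 b1 (some_coord b0 b0)) / s\<^sup>2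
    \<le> d' + e' - d' * e'"
proof -
  define A where "A = (\<lambda>x y i. measure_pmf.prob (\<alpha> x y) {a. \<not> a $ i})"
  define B where "B = (\<lambda>x y i. measure_pmf.prob (\<beta> x y) {b. \<not> b $ i})"
  let ?t = "P b0 b1 (some_coord b0 b1) + P b1 b0 (some_coord b1 b0) + P b1 b1 (some_coord b0 b0)"
  have t0: "0 \<le> ?t / s\<^sup>2" by (simp add: P_def)
  have "1 * s \<le> real CARD('n) * s"
    using s(1) by (intro mult_right_mono) (auto simp: Suc_le_eq)
  then have sde: "s \<le> 1 - d" "s \<le> 1 - e" using s by linarith+
  have d'e': "0 \<le> d'" "0 \<le> e'" "d' \<le> 1" "e' \<le> 1"
    using s de by (auto simp: d'_def e'_def)
  \<comment> \<open>This is the probability that at least one of two independent events of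
    probabilities \<open>d'\<close> and \<open>e'\<close> occurs.\<close>
  have rhs: "d' + e' - d' * e' = 1 - (1 - d') * (1 - e')"
    by (simp add: algebra_simps)
  have compl: "measure_pmf.prob p {a. a $ i} = 1 - measure_pmf.prob p {a. \<not> a $ i}"
    for p :: "(bool ^ 'n) pmf" and i
    using measure_pmf.prob_compl[of "{a. \<not> a $ i}" p] by (simp add: set_diff_eq)
  show ?thesis
  proof (cases "\<forall>i. A b0 b1 i \<le> s \<or> B b1 b0 i \<le> s")
    case True
    define G where "G = {i. A b0 b1 i \<le> s}"
    let ?FA = "{a :: bool ^ 'n. \<exists>i\<in>G. \<not> a $ i}" and ?FB = "{b :: bool ^ 'n. \<exists>i\<in>- G. \<not> b $ i}"
    have fa: "measure_pmf.prob (\<alpha> b0 b0) ?FA \<le> d'"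
      using prob_ex_coord_le[of G "\<alpha> b0 b1" s] \<alpha>[of b0 b0 ?FA b1] s
      by (auto simp: G_def A_def d'_def)
    have fb: "measure_pmf.prob (\<beta> b0 b0) ?FB \<le> e'"
    proof -
      have "measure_pmf.prob (\<beta> b1 b0) ?FB \<le> real CARD('n) * s"
        using True s by (intro prob_ex_coord_le) (auto simp: G_def B_def)
      then show ?thesis
        using \<beta>[of b0 b0 ?FB b1] by (simp add: e'_def)
    qed
    \<comment> \<open>Neither party's event occurs on \<open>?C\<close>. It is a rectangle, so its
      probability factors.\<close>
    let ?C = "(- ?FA) \<times> (- ?FB)"
    have sub: "some_coord b0 b0 \<subseteq> - ?C"
      by (auto simp: some_coord_def)
    have "P b0 b0 (some_coord b0 b0) \<le> P b0 b0 (- ?C)"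
      unfolding P_def using sub by (intro measure_pmf.finite_measure_mono) auto
    also have "\<dots> = 1 - P b0 b0 ?C"
      unfolding P_def using measure_pmf.prob_compl[of ?C] by (simp add: Compl_eq_Diff_UNIV)
    also have "P b0 b0 ?C = (1 - measure_pmf.prob (\<alpha> b0 b0) ?FA) * (1 - measure_pmf.prob (\<beta> b0 b0) ?FB)"
      unfolding P_def prob_pair_pmf_Times
      using measure_pmf.prob_compl[of ?FA "\<alpha> b0 b0"] measure_pmf.prob_compl[of ?FB "\<beta> b0 b0"]
      by (simp add: Compl_eq_Diff_UNIV)
    also have "1 - \<dots> \<le> 1 - (1 - d') * (1 - e')"
      using fa fb d'e' by (intro diff_left_mono mult_mono) auto
    finally show ?thesis using t0 rhs by linarith
  next
    case False
    then obtain i where i: "s \<le> A b0 b1 i" "s \<le> B b1 b0 i" by (meson le_cases)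
    have mono: "measure_pmf.prob (\<alpha> x y) C * measure_pmf.prob (\<beta> x y) D \<le> P x y E"
      if "C \<times> D \<subseteq> E" for x y C D E
      unfolding P_def prob_pair_pmf_Times[symmetric]
      using that by (intro measure_pmf.finite_measure_mono) auto
    \<comment> \<open>Prescribing both bits at coordinate \<open>i\<close> gives a rectangle inside
      each penalised event.\<close>
    have "A b0 b1 i * (1 - B b0 b1 i) \<le> P b0 b1 (some_coord b0 b1)"
      unfolding A_def B_def compl[symmetric] by (rule mono) (auto simp: some_coord_def)
    moreover have "(1 - A b1 b0 i) * B b1 b0 i \<le> P b1 b0 (some_coord b1 b0)"
      unfolding A_def B_def compl[symmetric] by (rule mono) (auto simp: some_coord_def)
    moreover have "A b1 b1 i * B b1 b1 i \<le> P b1 b1 (some_coord b0 b0)"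
      unfolding A_def B_def by (rule mono) (auto simp: some_coord_def)
    moreover have "s\<^sup>2 \<le> A b0 b1 i * (1 - B b0 b1 i) + (1 - A b1 b0 i) * B b1 b0 i + A b1 b1 i * B b1 b1 i"
      using s(1) sde i \<alpha>[of b1 b0 _ b1] \<beta>[of b0 b1 _ b1]
      by (intro penalty_lower_bound[where d = d and e = e])
        (auto simp: A_def B_def diff_le_eq)
    ultimately have "s\<^sup>2 \<le> ?t" by linarith
    then have "1 \<le> ?t / s\<^sup>2" using s(1) by (simp add: field_simps)
    moreover have "P b0 b0 (some_coord b0 b0) \<le> 1" by (simp add: P_def)
    \<comment> \<open>The penalty makes the left side of the goal at most 0, so it suffices that the
      right side is nonnegative.\<close>
    moreover have "(1 - d') * (1 - e') \<le> 1" using d'e' by (intro mult_le_one) auto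
    ultimately show ?thesis using rhs by linarith
  qed
qed

section \<open>Marginals, and integration over the hidden variable\<close>

lemma marginal_A_eq_pmf_fst: "marginal_A R a h x y = pmf (map_pmf fst (R h x y)) a"
proof -
  have "pmf (map_pmf fst (R h x y)) a = measure_pmf.prob (R h x y) (Pair a ` UNIV)"
    unfolding pmf_map by (rule arg_cong[where f = "measure_pmf.prob _"]) (auto simp: image_iff)
  then show ?thesis
    by (simp add: marginal_A_def measure_measure_pmf_finite sum.reindex inj_on_def)
qed

lemma marginal_B_eq_pmf_snd: "marginal_B R b h x y = pmf (map_pmf snd (R h x y)) b"
proof -
  have "pmf (map_pmf snd (R h x y)) b = measure_pmf.prob (R h x y) ((\<lambda>a. (a, b)) ` UNIV)"
    unfolding pmf_map by (rule arg_cong[where f = "measure_pmf.prob _"]) (auto simp: image_iff)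
  then show ?thesis
    by (simp add: marginal_B_def measure_measure_pmf_finite sum.reindex inj_on_def)
qed

text \<open>Factorisation of the point probabilities determines the whole distribution, so that the
  estimate for product distributions applies to \<open>R h x y\<close>.\<close>

lemma outcome_independent_imp_pair_pmf:
  assumes "outcome_independent M R" "h \<in> space M"
  shows "R h x y = pair_pmf (map_pmf fst (R h x y)) (map_pmf snd (R h x y))"
  by (rule pmf_eqI)
    (use assms in \<open>auto simp: outcome_independent_def pmf_pair marginal_A_eq_pmf_fst marginal_B_eq_pmf_snd\<close>)

text \<open>The model provides measurability for point probabilities only. As outcomes are finite in
  number, an event is a finite sum of them, which commutes with the integral; boundedness on a
  probability space gives integrability.\<close>

lemma
  assumes "hv_model M S (R :: _ \<Rightarrow> _ \<Rightarrow> _ \<Rightarrow> ('a::finite \<times> 'b::finite) pmf)"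
  shows integrable_setting: "integrable M (\<lambda>h. pmf (S h) (x, y))"
    and integrable_setting_event:
      "integrable M (\<lambda>h. pmf (S h) (x, y) * measure_pmf.prob (R h x y) E)"
    and sum_correlation_eq_integral: "(\<Sum>(a, b)\<in>E. correlation M S R a b x y) =
      1 / setting_dist M S x y * (\<integral>h. pmf (S h) (x, y) * measure_pmf.prob (R h x y) E \<partial>M)"
proof -
  interpret prob_space M using assms by (simp add: hv_model_def)
  have [measurable]: "(\<lambda>h. pmf (S h) (x, y)) \<in> borel_measurable M"
    "(\<lambda>h. pmf (R h x y) z) \<in> borel_measurable M" for z
    using assms by (cases z; simp add: hv_model_def)+
  show "integrable M (\<lambda>h. pmf (S h) (x, y))"
    by (rule integrable_const_bound[where B = 1]) (auto simp: pmf_le_1)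
  have i: "integrable M (\<lambda>h. pmf (S h) (x, y) * pmf (R h x y) z)" for z
    by (rule integrable_const_bound[where B = 1]) (auto simp: pmf_le_1 intro!: mult_le_one)
  have eq: "pmf (S h) (x, y) * measure_pmf.prob (R h x y) E =
      (\<Sum>z\<in>E. pmf (S h) (x, y) * pmf (R h x y) z)" for h
    by (simp add: measure_measure_pmf_finite sum_distrib_left)
  show "integrable M (\<lambda>h. pmf (S h) (x, y) * measure_pmf.prob (R h x y) E)"
    unfolding eq using i by auto
  show "(\<Sum>(a, b)\<in>E. correlation M S R a b x y) =
      1 / setting_dist M S x y * (\<integral>h. pmf (S h) (x, y) * measure_pmf.prob (R h x y) E \<partial>M)"
    unfolding eq using i
    by (simp add: correlation_def Bochner_Integration.integral_sum sum_distrib_left sum_divide_distrib split_beta)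
qed

theorem mainTheorem5:
  fixes N :: nat
    and l \<kappa> \<epsilon>A \<epsilon>B \<epsilon> \<epsilon>A' \<epsilon>B' :: real
    and M :: "'l measure"
    and S :: "'l \<Rightarrow> (bool \<times> bool) pmf"
    and R :: "'l \<Rightarrow> bool \<Rightarrow> bool \<Rightarrow> ((bool ^ 'n::finite) \<times> (bool ^ 'n)) pmf"
  assumes "N = CARD('n)" and "N \<ge> 2"
    and "l > 0"
    and "\<epsilon>A \<in> {0..<1}" and "\<epsilon>B \<in> {0..<1}"
    and "\<epsilon> = max \<epsilon>A \<epsilon>B"
    and "\<kappa> > (real N)\<^sup>2 / (l * (1 - \<epsilon>)\<^sup>2)"
    and "hv_model M S R"
    and "measurement_dependent l M S"
    and "parameter_dependent \<epsilon>A \<epsilon>B M R"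
    and "outcome_independent M R"
    and "\<And>x y. setting_dist M S x y = 1 / 4"
    and "\<epsilon>A' = \<epsilon>A + real N * sqrt (1 / (l * \<kappa>))"
    and "\<epsilon>B' = \<epsilon>B + real N * sqrt (1 / (l * \<kappa>))"
  shows "I_functional \<kappa> (correlation M S R) \<le> \<epsilon>A' + \<epsilon>B' - \<epsilon>A' * \<epsilon>B'"
proof -
  define s where "s = sqrt (1 / (l * \<kappa>))"
  have N: "0 < real N" using assms(2) by simp
  have \<epsilon>: "\<epsilon> < 1" "\<epsilon>A \<le> \<epsilon>" "\<epsilon>B \<le> \<epsilon>" using assms(4-6) by auto
  have l\<kappa>: "(real N)\<^sup>2 / (1 - \<epsilon>)\<^sup>2 < l * \<kappa>"
    using assms(3,7) \<epsilon>(1) by (simp add: field_simps)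
  moreover have "0 < (real N)\<^sup>2 / (1 - \<epsilon>)\<^sup>2" using N \<epsilon>(1) by simp
  ultimately have l\<kappa>0: "0 < l * \<kappa>" by linarith
  then have \<kappa>: "0 < \<kappa>" using assms(3) by (simp add: zero_less_mult_iff)
  have s0: "0 < s" using l\<kappa>0 by (simp add: s_def)
  have s2: "s\<^sup>2 = 1 / (l * \<kappa>)" using l\<kappa>0 by (simp add: s_def)
  \<comment> \<open>The lower bound on \<open>\<kappa>\<close> enters here: it makes
    \<open>\<epsilon>A'\<close> and \<open>\<epsilon>B'\<close> at most 1, as the estimate for a
    fixed hidden variable demands.\<close>
  have "(real N * s)\<^sup>2 \<le> (1 - \<epsilon>)\<^sup>2"
    using l\<kappa> l\<kappa>0 \<epsilon>(1) by (simp add: power_mult_distrib s2 field_simps)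
  then have Ns: "real N * s \<le> 1 - \<epsilon>" by (rule power2_le_imp_le) (use \<epsilon>(1) in simp)
  have \<epsilon>': "\<epsilon>A' = \<epsilon>A + real CARD('n) * s" "\<epsilon>B' = \<epsilon>B + real CARD('n) * s"
    using assms(1,13,14) by (simp_all add: s_def)
  define P where "P = (\<lambda>h x y. measure_pmf.prob (R h x y))"
  let ?B = "\<epsilon>A' + \<epsilon>B' - \<epsilon>A' * \<epsilon>B'"
  define W where "W = (\<lambda>h x y E. pmf (S h) (x, y) * P h x y E)"
  have strategy: "P h b0 b0 (some_coord b0 b0) - l * \<kappa> * (P h b0 b1 (some_coord b0 b1)
      + P h b1 b0 (some_coord b1 b0) + P h b1 b1 (some_coord b0 b0)) \<le> ?B"
    if h: "h \<in> space M" for h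
  proof -
    let ?\<alpha> = "\<lambda>x y. map_pmf fst (R h x y)" and ?\<beta> = "\<lambda>x y. map_pmf snd (R h x y)"
    have \<alpha>: "measure_pmf.prob (?\<alpha> x y) F \<le> measure_pmf.prob (?\<alpha> x y') F + \<epsilon>A" for x y y' F
    proof -
      have "1 / 2 * (\<Sum>a\<in>UNIV. \<bar>pmf (?\<alpha> x y) a - pmf (?\<alpha> x y') a\<bar>) \<le> \<epsilon>A"
        using assms(10) h
        unfolding parameter_dependent_def marginal_A_eq_pmf_fst marginal_B_eq_pmf_snd by blast
      then show ?thesis
        using prob_le_prob_plus_total_variation[of "?\<alpha> x y" F "?\<alpha> x y'"] by linarith
    qed
    have \<beta>: "measure_pmf.prob (?\<beta> x y) F \<le> measure_pmf.prob (?\<beta> x' y) F + \<epsilon>B" for x x' y F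
    proof -
      have "1 / 2 * (\<Sum>a\<in>UNIV. \<bar>pmf (?\<beta> x y) a - pmf (?\<beta> x' y) a\<bar>) \<le> \<epsilon>B"
        using assms(10) h
        unfolding parameter_dependent_def marginal_A_eq_pmf_fst marginal_B_eq_pmf_snd by blast
      then show ?thesis
        using prob_le_prob_plus_total_variation[of "?\<beta> x y" F "?\<beta> x' y"] by linarith
    qed
    show ?thesis
      using product_strategy_bound[of s \<epsilon>A \<epsilon>B ?\<alpha> ?\<beta>, OF s0 _ _ _ _ \<alpha> \<beta>] Ns \<epsilon> assms(1,4,5)
      by (simp add: outcome_independent_imp_pair_pmf[OF assms(11) h, symmetric] s2 P_def
          \<epsilon>' mult.commute)
  qed
  have pointwise: "W h b0 b0 (some_coord b0 b0) - \<kappa> * W h b0 b1 (some_coord b0 b1)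
      - \<kappa> * W h b1 b0 (some_coord b1 b0) - \<kappa> * W h b1 b1 (some_coord b0 b0)
      \<le> pmf (S h) (b0, b0) * ?B" if h: "h \<in> space M" for h
  proof -
    let ?p = "pmf (S h) (b0, b0)"
    \<comment> \<open>Each penalty carries its own setting probability; this trades it for the
      common factor \<open>?p\<close> at the price of \<open>l\<close>.\<close>
    have le: "?p * (l * \<kappa> * P h x y E) \<le> \<kappa> * W h x y E" for x y E
    proof -
      have "l * ?p \<le> l * 1" using assms(3) by (intro mult_left_mono) (auto simp: pmf_le_1)
      also have "\<dots> \<le> pmf (S h) (x, y)"
        using assms(9) h by (auto simp: measurement_dependent_def)
      finally have "\<kappa> * P h x y E * (l * ?p) \<le> \<kappa> * P h x y E * pmf (S h) (x, y)"
        using \<kappa> by (intro mult_left_mono) (auto simp: P_def)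
      then show ?thesis by (simp add: W_def ac_simps)
    qed
    have "?p * (P h b0 b0 (some_coord b0 b0) - l * \<kappa> * (P h b0 b1 (some_coord b0 b1)
      + P h b1 b0 (some_coord b1 b0) + P h b1 b1 (some_coord b0 b0))) \<le> ?p * ?B"
      using strategy[OF h] by (intro mult_left_mono) auto
    then show ?thesis
      using le[of b0 b1 "some_coord b0 b1"] le[of b1 b0 "some_coord b1 b0"]
        le[of b1 b1 "some_coord b0 b0"]
      by (simp add: W_def algebra_simps)
  qed
  have W: "integrable M (\<lambda>h. W h x y E)" for x y E
    unfolding W_def P_def by (rule integrable_setting_event[OF assms(8)])
  \<comment> \<open>Uniform settings give all four correlation sums the same normalisation 4, so
    they merge into one integral.\<close>
  have "I_functional \<kappa> (correlation M S R) =
      4 * (\<integral>h. W h b0 b0 (some_coord b0 b0) - \<kappa> * W h b0 b1 (some_coord b0 b1)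
      - \<kappa> * W h b1 b0 (some_coord b1 b0) - \<kappa> * W h b1 b1 (some_coord b0 b0) \<partial>M)"
    unfolding I_functional_def sum_correlation_eq_integral[OF assms(8)] assms(12)
    using W by (simp add: W_def P_def algebra_simps)
  also have "\<dots> \<le> 4 * (\<integral>h. pmf (S h) (b0, b0) * ?B \<partial>M)"
    using pointwise W integrable_setting[OF assms(8)]
    by (intro mult_left_mono integral_mono) auto
  \<comment> \<open>The integral of p(0,0|\<lambda>) is 1/4, which cancels the factor 4.\<close>
  also have "\<dots> = ?B"
    using assms(12)[of b0 b0] integrable_setting[OF assms(8)] by (simp add: setting_dist_def)
  finally show ?thesis .
qed


end
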